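(* Assume that $\alpha_n$ is bounded above, $n \alpha_n \to \infty$ and $\log \alpha_n / \log n$ is bounded away from $0$. Then $$M_n - \log (n \alpha_n) - (\alpha_n - 1) \log \log (n \alpha_n)$$ converges in distribution to $G$ as $n\to\infty$.
   Context: Let $(\alpha_n)_{n\ge 1}$ be a sequence of positive real numbers. For each $n$, let $Y_{1n},\ldots,Y_{nn}$ be i.i.d. random variables with the Gamma$(\alpha_n,1)$ distribution, i.e. with density $u^{\alpha_n-1}e^{-u}/\Gamma(\alpha_n)$ on $(0,\infty)$, and let $M_n=\max\{Y_{1n},\ldots,Y_{nn}\}$. $G$ denotes the Gumbel distribution, with distribution function $G(x)=\exp(-e^{-x})$, $x\in\mathbb R$. *)

theory Defs
  imports "HOL-Probability.Probability"
begin

text \<open>Density of the Gamma distribution with shape \<^term>\<open>a\<close> and rate 1; it is meant for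
  \<open>a > 0\<close>. The Erlang density of the library covers integer shapes only.\<close>

definition gamma_density :: "real \<Rightarrow> real \<Rightarrow> real" where
  "gamma_density a u = (if u > 0 then u powr (a - 1) * exp (- u) / Gamma a else 0)"

definition gumbel_cdf :: "real \<Rightarrow> real" where
  "gumbel_cdf x = exp (- exp (- x))"

definition gumbel :: "real measure" where
  "gumbel = interval_measure gumbel_cdf"

text \<open>The next lemmas confirm that \<open>gumbel\<close> is the probability measure with distribution
  function \<open>gumbel_cdf\<close>: \<open>interval_measure\<close> is arbitrary unless its argument is
  monotone and right-continuous.\<close>

lemma gumbel_cdf_mono: "x \<le> y \<Longrightarrow> gumbel_cdf x \<le> gumbel_cdf y"
  by (simp add: gumbel_cdf_def)

lemma gumbel_cdf_continuous: "continuous (at x within S) gumbel_cdf"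
  unfolding gumbel_cdf_def by (intro continuous_intros)

lemma gumbel_cdf_at_bot: "(gumbel_cdf \<longlongrightarrow> 0) at_bot"
  unfolding gumbel_cdf_def
  by (intro filterlim_compose[OF exp_at_bot]
      filterlim_compose[OF filterlim_uminus_at_bot_at_top]
      filterlim_compose[OF exp_at_top] filterlim_uminus_at_top_at_bot)

lemma gumbel_cdf_at_top: "(gumbel_cdf \<longlongrightarrow> 1) at_top"
proof -
  have "((\<lambda>x::real. exp (- x)) \<longlongrightarrow> 0) at_top"
    by (intro filterlim_compose[OF exp_at_bot] filterlim_uminus_at_bot_at_top)
  from tendsto_exp[OF tendsto_minus[OF this]] show ?thesis
    by (simp add: gumbel_cdf_def[abs_def])
qed

lemma real_distribution_gumbel: "real_distribution gumbel"
  unfolding gumbel_def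
  by (rule real_distribution_interval_measure)
    (auto simp: gumbel_cdf_mono gumbel_cdf_continuous gumbel_cdf_at_bot gumbel_cdf_at_top)

lemma cdf_gumbel: "cdf gumbel = gumbel_cdf"
  unfolding gumbel_def
  by (rule cdf_interval_measure)
    (auto simp: gumbel_cdf_mono gumbel_cdf_continuous gumbel_cdf_at_bot gumbel_cdf_at_top)

end

theory Submission
  imports Defs
begin

text \<open>Since \<open>\<alpha>\<^sub>n\<close> is bounded above, the growth condition on \<open>ln \<alpha>\<^sub>n\<close> forces
  \<open>\<alpha>\<^sub>n \<longlonglongrightarrow> 0\<close>. For shape \<open>a \<le> 1\<close> the tail of the Gamma distribution beyond a large \<open>x\<close> is
  \<open>x powr (a - 1) * exp (- x) / Gamma a\<close> up to a factor between \<open>x / (x + 1)\<close> and \<open>1\<close>. With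
  \<open>L = ln (n * \<alpha>\<^sub>n)\<close>, the threshold \<open>x = L + (\<alpha>\<^sub>n - 1) * ln L + t\<close> is asymptotic to \<open>L\<close>, so that
  \<open>n\<close> times this tail is asymptotic to \<open>exp (- t) / Gamma (\<alpha>\<^sub>n + 1)\<close>, which tends to
  \<open>exp (- t)\<close>. The claim is then the Poisson limit \<open>(1 - p\<^sub>n) ^ n \<longlonglongrightarrow> exp (- lim (n * p\<^sub>n))\<close>.\<close>

text \<open>\<open>n * ln (1 - p n)\<close> differs from \<open>- n * p n\<close> by at most
  \<open>2 * n * (p n)\<^sup>2\<close> for large n. This error vanishes, being twice the convergent
  sequence \<open>n * p n\<close> times the null sequence \<open>p n\<close>.\<close>

lemma tendsto_one_minus_power:
  fixes p :: "nat \<Rightarrow> real"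
  assumes p: "\<forall>\<^sub>F n in sequentially. 0 \<le> p n"
    and lim: "(\<lambda>n. real n * p n) \<longlonglongrightarrow> l"
  shows "(\<lambda>n. (1 - p n) ^ n) \<longlonglongrightarrow> exp (- l)"
proof -
  have "(\<lambda>n. (real n * p n) * (1 / real n)) \<longlonglongrightarrow> l * 0"
    by (intro tendsto_mult lim lim_1_over_n)
  moreover have "\<forall>\<^sub>F n in sequentially. (real n * p n) * (1 / real n) = p n"
    using eventually_gt_at_top[of 0] by eventually_elim simp
  ultimately have p0: "p \<longlonglongrightarrow> 0"
    using Lim_transform_eventually by fastforce
  \<comment> \<open>The lower bound \<open>- p - 2 * p\<^sup>2\<close> for \<open>ln (1 - p)\<close>
    is available for p in [0, 1/2].\<close>
  have small: "\<forall>\<^sub>F n in sequentially. p n < 1 / 2"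
    using order_tendstoD(2)[OF p0, of "1/2"] by simp
  have bounds: "exp (real n * (- p n - 2 * (p n)\<^sup>2)) \<le> (1 - p n) ^ n \<and> (1 - p n) ^ n \<le> exp (real n * - p n)"
    if "0 \<le> p n" "p n < 1 / 2" for n
  proof -
    have "(1 - p n) ^ n = exp (real n * ln (1 - p n))"
      using that by (simp add: exp_of_nat_mult)
    moreover have "- p n - 2 * (p n)\<^sup>2 \<le> ln (1 - p n)" "ln (1 - p n) \<le> - p n"
      using that by (auto intro!: ln_one_minus_pos_lower_bound ln_one_minus_pos_upper_bound)
    ultimately show ?thesis
      by (simp only: exp_le_cancel_iff mult_left_mono of_nat_0_le_iff)
  qed
  show ?thesis
  proof (rule tendsto_sandwich)
    show "\<forall>\<^sub>F n in sequentially. exp (real n * (- p n - 2 * (p n)\<^sup>2)) \<le> (1 - p n) ^ n"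
      using p small by eventually_elim (use bounds in blast)
    show "\<forall>\<^sub>F n in sequentially. (1 - p n) ^ n \<le> exp (real n * - p n)"
      using p small by eventually_elim (use bounds in blast)
    have "(\<lambda>n. exp (- (real n * p n) - 2 * (real n * p n) * p n)) \<longlonglongrightarrow> exp (- l - 2 * l * 0)"
      by (intro tendsto_intros lim p0)
    then show "(\<lambda>n. exp (real n * (- p n - 2 * (p n)\<^sup>2))) \<longlonglongrightarrow> exp (- l)"
      by (simp add: algebra_simps power2_eq_square)
    show "(\<lambda>n. exp (real n * - p n)) \<longlonglongrightarrow> exp (- l)"
      using tendsto_exp[OF tendsto_minus[OF lim]] by simp
  qed
qed

text \<open>Both bounds compare the density with \<open>(1 + (1 - a) / u)\<close> times it, which has the elementary
  primitive \<open>- u powr (a - 1) * exp (- u) / Gamma a\<close>.\<close>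

lemma (in prob_space) gamma_tail_bounds:
  fixes a x :: real
  assumes X: "distributed M lborel X (\<lambda>u. ennreal (gamma_density a u))"
    and a: "0 < a" "a \<le> 1" and x: "0 < x"
  defines "C \<equiv> x powr (a - 1) * exp (- x) / Gamma a"
  shows "C * (x / (x + 1)) \<le> prob (X -` {x<..} \<inter> space M)"
    and "prob (X -` {x<..} \<inter> space M) \<le> C"
proof -
  define F where "F u = - (u powr (a - 1) * exp (- u) / Gamma a)" for u :: real
  define f where "f u = u powr (a - 1) * exp (- u) / Gamma a * (1 + (1 - a) / u)" for u :: real
  have Gpos: "Gamma a > 0" using a by simp
  \<comment> \<open>Since \<open>a \<le> 1\<close>, the power is at most 1 for
    \<open>u \<ge> 1\<close>, so the exponential alone dominates.\<close>
  have F0: "(F \<longlongrightarrow> 0) at_top"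
  proof (rule tendsto_rabs_zero_cancel, rule tendsto_sandwich)
    show "\<forall>\<^sub>F u in at_top. 0 \<le> \<bar>F u\<bar>" by simp
    show "((\<lambda>_. 0) \<longlongrightarrow> (0::real)) at_top" by simp
    have "((\<lambda>u. exp (- u) / Gamma a) \<longlongrightarrow> 0 / Gamma a) at_top"
      by (intro tendsto_divide tendsto_const filterlim_compose[OF exp_at_bot]
          filterlim_uminus_at_bot_at_top) (use Gpos in auto)
    then show "((\<lambda>u. exp (- u) / Gamma a) \<longlongrightarrow> 0) at_top" by simp
    show "\<forall>\<^sub>F u in at_top. \<bar>F u\<bar> \<le> exp (- u) / Gamma a"
      using eventually_ge_at_top[of 1]
    proof eventually_elim
      case (elim u)
      have "u powr (a - 1) \<le> u powr 0"
        using elim a by (intro powr_mono) auto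
      then show ?case
        using elim Gpos by (auto simp: F_def abs_mult intro!: divide_right_mono)
    qed
  qed
  have "(\<integral>\<^sup>+u. ennreal (f u) * indicator {x..} u \<partial>lborel) = ennreal (0 - F x)"
  proof (rule nn_integral_FTC_atLeast[OF _ _ _ F0])
    show "f \<in> borel_measurable borel" unfolding f_def by measurable
    show "(F has_real_derivative f u) (at u)" if "x \<le> u" for u
    proof -
      have u: "u > 0" using that x by simp
      have "((\<lambda>u. exp (- u)) has_real_derivative - exp (- u)) (at u)"
        by (auto intro!: derivative_eq_intros)
      then have "(F has_real_derivative
          - (((a - 1) * u powr (a - 1 - 1) * exp (- u) + - exp (- u) * u powr (a - 1)) / Gamma a)) (at u)"
        unfolding F_def by (intro DERIV_minus DERIV_cdivide DERIV_mult has_real_derivative_powr u)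
      also have "- (((a - 1) * u powr (a - 1 - 1) * exp (- u) + - exp (- u) * u powr (a - 1)) / Gamma a)
          = f u"
        unfolding f_def using u Gpos by (simp add: powr_diff field_simps power2_eq_square)
      finally show ?thesis .
    qed
    show "0 \<le> f u" if "x \<le> u" for u
      unfolding f_def using that x Gpos a by auto
  qed
  \<comment> \<open>The two half-lines differ by the Lebesgue null set {x}.\<close>
  moreover have "(\<integral>\<^sup>+u. ennreal (f u) * indicator {x..} u \<partial>lborel)
      = (\<integral>\<^sup>+u. ennreal (f u) * indicator {x<..} u \<partial>lborel)"
    by (intro nn_integral_cong_AE eventually_mono[OF AE_lborel_singleton[of x]])
       (auto simp: indicator_def)
  ultimately have If: "(\<integral>\<^sup>+u. ennreal (f u) * indicator {x<..} u \<partial>lborel) = ennreal C"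
    by (simp add: F_def C_def)
  have meas: "(\<lambda>u. ennreal (gamma_density a u)) \<in> borel_measurable lborel"
    using X by (rule distributed_borel_measurable)
  have Ig: "ennreal (prob (X -` {x<..} \<inter> space M))
      = (\<integral>\<^sup>+u. ennreal (gamma_density a u) * indicator {x<..} u \<partial>lborel)"
    using distributed_emeasure[OF X, of "{x<..}"] by (simp add: emeasure_eq_measure)
  have C0: "0 \<le> C" using Gpos by (simp add: C_def)
  have g_nonneg: "0 \<le> gamma_density a u" for u
    using Gpos by (simp add: gamma_density_def)
  have f_eq: "f u = gamma_density a u * (1 + (1 - a) / u)" if "x < u" for u
    using that x by (simp add: f_def gamma_density_def)
  \<comment> \<open>Upper bound: \<open>a \<le> 1\<close> makes the factor
    \<open>1 + (1 - a) / u\<close> at least 1.\<close>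
  have "ennreal (prob (X -` {x<..} \<inter> space M)) \<le> ennreal C"
    unfolding Ig If[symmetric]
  proof (intro nn_integral_mono)
    fix u
    have "gamma_density a u \<le> f u" if "x < u"
      unfolding f_eq[OF that] using that x a g_nonneg[of u]
      by (intro mult_right_le_one_le[THEN order_trans] order_refl | simp add: mult_le_cancel_left1)+
    then show "ennreal (gamma_density a u) * indicator {x<..} u \<le> ennreal (f u) * indicator {x<..} u"
      by (auto simp: indicator_def intro!: ennreal_leI)
  qed
  then show "prob (X -` {x<..} \<inter> space M) \<le> C"
    using C0 by simp
  \<comment> \<open>Lower bound: for \<open>u > x\<close> the factor \<open>1 + (1 - a) / u\<close>
    is at most \<open>K\<close>, and \<open>1 / K = x / (x + 1)\<close>.\<close>
  define K where "K = 1 + 1 / x"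
  have K: "K \<ge> 0" using x by (simp add: K_def)
  have "ennreal C \<le> (\<integral>\<^sup>+u. ennreal K * (ennreal (gamma_density a u) * indicator {x<..} u) \<partial>lborel)"
    unfolding If[symmetric]
  proof (intro nn_integral_mono)
    fix u
    have "f u \<le> K * gamma_density a u" if "x < u"
    proof -
      have "(1 - a) / u \<le> 1 / x" using that x a by (intro frac_le) auto
      then show ?thesis unfolding f_eq[OF that] using g_nonneg[of u]
        by (subst mult.commute) (intro mult_right_mono, auto simp: K_def)
    qed
    then show "ennreal (f u) * indicator {x<..} u
        \<le> ennreal K * (ennreal (gamma_density a u) * indicator {x<..} u)"
      using K g_nonneg[of u] by (auto simp: indicator_def ennreal_mult[symmetric] intro!: ennreal_leI)
  qed
  also have "\<dots> = ennreal K * ennreal (prob (X -` {x<..} \<inter> space M))"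
    unfolding Ig using meas by (subst nn_integral_cmult) auto
  finally have "C \<le> K * prob (X -` {x<..} \<inter> space M)"
    using K by (simp add: ennreal_mult[symmetric])
  then show "C * (x / (x + 1)) \<le> prob (X -` {x<..} \<inter> space M)"
    using x by (simp add: K_def field_simps)
qed

text \<open>The maximum is at most \<open>x\<close> exactly when every variable is, so independence
  gives a product. Identical distribution enters through the common tail \<open>p\<close> at
  \<open>x\<close>.\<close>

lemma (in prob_space) prob_Max_iid_le:
  fixes Y :: "nat \<Rightarrow> 'a \<Rightarrow> real"
  assumes indep: "indep_vars (\<lambda>_. borel) Y {1..n}" and n: "n \<ge> 1"
    and tail: "\<And>i. i \<in> {1..n} \<Longrightarrow> prob (Y i -` {x<..} \<inter> space M) = p"
  shows "prob {\<omega> \<in> space M. Max ((\<lambda>i. Y i \<omega>) ` {1..n}) \<le> x} = (1 - p) ^ n"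
proof -
  have ev: "prob (Y i -` {..x} \<inter> space M) = 1 - p" if "i \<in> {1..n}" for i
  proof -
    have [measurable]: "Y i \<in> borel_measurable M"
      using indep that by (auto simp: indep_vars_def)
    have "Y i -` {x<..} \<inter> space M \<in> events" by measurable
    from prob_compl[OF this] have "prob (space M - (Y i -` {x<..} \<inter> space M)) = 1 - p"
      by (simp add: tail[OF that])
    also have "space M - (Y i -` {x<..} \<inter> space M) = Y i -` {..x} \<inter> space M" by auto
    finally show ?thesis .
  qed
  have "{\<omega> \<in> space M. Max ((\<lambda>i. Y i \<omega>) ` {1..n}) \<le> x} = (\<Inter>i\<in>{1..n}. Y i -` {..x} \<inter> space M)"
    using n by (subst Max_le_iff) auto
  also have "prob \<dots> = (\<Prod>i\<in>{1..n}. prob (Y i -` {..x} \<inter> space M))"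
    using n by (intro indep_varsD_finite[OF indep]) auto
  also have "\<dots> = (1 - p) ^ n"
    using ev by (subst prod.cong[OF refl ev]) auto
  finally show ?thesis .
qed

text \<open>The ratio condition leaves two cases for large n: \<open>a n\<close> is at least
  \<open>n powr c\<close> or at most \<open>n powr (- c)\<close>. Boundedness above eventually
  excludes the first.\<close>

lemma tendsto_zero_of_ln_ratio:
  fixes a :: "nat \<Rightarrow> real"
  assumes pos: "\<And>n. n \<ge> 1 \<Longrightarrow> a n > 0"
    and bdd: "bdd_above (a ` {1..})"
    and c: "c > 0" "\<forall>\<^sub>F n in sequentially. \<bar>ln (a n) / ln (real n)\<bar> \<ge> c"
  shows "a \<longlonglongrightarrow> 0"
proof -
  from bdd obtain B where B: "\<And>n. n \<ge> 1 \<Longrightarrow> a n \<le> B"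
    by (auto simp: bdd_above_def)
  have cln: "filterlim (\<lambda>n. c * ln (real n)) at_top sequentially"
    by (intro filterlim_tendsto_pos_mult_at_top[OF tendsto_const c(1)]
        filterlim_compose[OF ln_at_top] filterlim_real_sequentially)
  show ?thesis
  proof (rule tendsto_sandwich)
    show "\<forall>\<^sub>F n in sequentially. 0 \<le> a n"
      using eventually_ge_at_top[of 1] by eventually_elim (rule less_imp_le[OF pos])
    show "(\<lambda>n. exp (- (c * ln (real n)))) \<longlonglongrightarrow> 0"
      by (intro filterlim_compose[OF exp_at_bot] filterlim_compose[OF filterlim_uminus_at_bot_at_top] cln)
    show "\<forall>\<^sub>F n in sequentially. a n \<le> exp (- (c * ln (real n)))"
      using c(2) filterlim_at_top_dense[THEN iffD1, OF cln, rule_format, of "ln B"]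
        eventually_ge_at_top[of 2]
    proof eventually_elim
      case (elim n)
      have an: "a n > 0" "a n \<le> B" using pos[of n] B[of n] elim by auto
      have "ln (real n) > 0" using elim by simp
      with elim(1) have "c * ln (real n) \<le> \<bar>ln (a n)\<bar>"
        by (simp add: field_simps abs_divide)
      moreover have "ln (a n) \<le> ln B" using an by simp
      \<comment> \<open>The chain
        \<open>ln (a n) \<le> ln B < c * ln n \<le> \<bar>ln (a n)\<bar>\<close> forces
        \<open>ln (a n)\<close> to be negative.\<close>
      ultimately have "ln (a n) \<le> - (c * ln (real n))" using elim(2) by linarith
      then have "exp (ln (a n)) \<le> exp (- (c * ln (real n)))" by (simp only: exp_le_cancel_iff)
      then show ?case using an by simp
    qed
  qed auto
qed

text \<open>The shift \<open>(a n - 1) * ln (L n)\<close> makes \<open>exp (- x n)\<close>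
  contribute \<open>L n powr (1 - a n)\<close>, which turns \<open>x n powr (a n - 1)\<close> into a
  power of \<open>x n / L n\<close>. The factor \<open>1 / (n * a n)\<close> from
  \<open>exp (- L n)\<close> cancels n and turns \<open>Gamma (a n)\<close> into
  \<open>Gamma (a n + 1)\<close>.\<close>

lemma tendsto_gumbel_tail:
  fixes a :: "nat \<Rightarrow> real" and t :: real
  defines "L \<equiv> \<lambda>n. ln (real n * a n)"
  defines "x \<equiv> \<lambda>n. L n + (a n - 1) * ln (L n) + t"
  assumes pos: "\<And>n. n \<ge> 1 \<Longrightarrow> a n > 0" and a0: "a \<longlonglongrightarrow> 0"
    and na: "filterlim (\<lambda>n. real n * a n) at_top sequentially"
  shows "filterlim x at_top sequentially"
    and "(\<lambda>n. real n * (x n powr (a n - 1) * exp (- x n) / Gamma (a n))) \<longlonglongrightarrow> exp (- t)"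
proof -
  have L: "filterlim L at_top sequentially"
    unfolding L_def by (rule filterlim_compose[OF ln_at_top na])
  \<comment> \<open>After division by \<open>L n\<close> only the leading term survives:
    \<open>ln L / L\<close> and \<open>t / L\<close> vanish while \<open>a n - 1\<close> stays
    bounded.\<close>
  have "(\<lambda>n. 1 + (a n - 1) * (ln (L n) / L n) + t / L n) \<longlonglongrightarrow> 1 + (0 - 1) * 0 + 0"
    by (intro tendsto_intros a0 filterlim_compose[OF ln_x_over_x_tendsto_0 L]
        real_tendsto_divide_at_top[OF tendsto_const L])
  moreover have "\<forall>\<^sub>F n in sequentially. 1 + (a n - 1) * (ln (L n) / L n) + t / L n = x n / L n"
    using filterlim_at_top_dense[THEN iffD1, OF L, rule_format, of 0]
    by eventually_elim (simp add: x_def field_simps)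
  ultimately have ratio: "(\<lambda>n. x n / L n) \<longlonglongrightarrow> 1"
    using Lim_transform_eventually by fastforce
  have "filterlim (\<lambda>n. x n / L n * L n) at_top sequentially"
    by (rule filterlim_tendsto_pos_mult_at_top[OF ratio _ L]) simp
  moreover have "\<forall>\<^sub>F n in sequentially. x n / L n * L n = x n"
    using filterlim_at_top_dense[THEN iffD1, OF L, rule_format, of 0]
    by eventually_elim simp
  ultimately show X: "filterlim x at_top sequentially"
    using filterlim_cong by fast
  \<comment> \<open>The argument \<open>a n + 1\<close> stays away from the pole of
    \<open>Gamma\<close> at 0 and tends to 1, where \<open>Gamma\<close> is continuous with value
    1.\<close>
  have "(\<lambda>n. exp (- t) * ((x n / L n) powr (a n - 1) / Gamma (a n + 1)))
      \<longlonglongrightarrow> exp (- t) * (1 powr (0 - 1) / Gamma (0 + 1))"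
    by (intro tendsto_intros ratio a0) (auto simp: Gamma_eq_zero_iff)
  \<comment> \<open>An exact identity, not just an asymptotic one, once \<open>L n\<close> and
    \<open>x n\<close> are positive and the power of the quotient splits.\<close>
  moreover have "\<forall>\<^sub>F n in sequentially. exp (- t) * ((x n / L n) powr (a n - 1) / Gamma (a n + 1))
      = real n * (x n powr (a n - 1) * exp (- x n) / Gamma (a n))"
    using filterlim_at_top_dense[THEN iffD1, OF L, rule_format, of 0]
      filterlim_at_top_dense[THEN iffD1, OF X, rule_format, of 0] eventually_ge_at_top[of 1]
  proof eventually_elim
    case (elim n)
    have an: "a n > 0" using pos elim by simp
    then have G: "Gamma (a n + 1) = a n * Gamma (a n)" "Gamma (a n) > 0"
      by (auto intro!: Gamma_plus1 dest: nonpos_Ints_nonpos)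
    have "exp (- x n) = exp (- t) * exp (- L n) * exp (- ((a n - 1) * ln (L n)))"
      by (simp add: x_def exp_add[symmetric])
    also have "exp (- L n) = 1 / (real n * a n)"
      using an elim by (simp add: L_def exp_minus field_simps)
    also have "exp (- ((a n - 1) * ln (L n))) = 1 / L n powr (a n - 1)"
      using elim by (simp add: powr_def exp_minus inverse_eq_divide)
    finally have exp_x: "exp (- x n) = exp (- t) * (1 / (real n * a n)) * (1 / L n powr (a n - 1))" .
    show ?case
      unfolding exp_x G(1) using an elim by (simp add: powr_divide mult_ac)
  qed
  ultimately show "(\<lambda>n. real n * (x n powr (a n - 1) * exp (- x n) / Gamma (a n))) \<longlonglongrightarrow> exp (- t)"
    using Lim_transform_eventually by fastforce
qed

theorem theorem2p5:
  fixes \<alpha> :: "nat \<Rightarrow> real"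
    and P :: "nat \<Rightarrow> 'a measure"
    and Y :: "nat \<Rightarrow> nat \<Rightarrow> 'a \<Rightarrow> real"
    and M :: "nat \<Rightarrow> 'a \<Rightarrow> real"
  assumes \<alpha>_pos: "\<And>n. n \<ge> 1 \<Longrightarrow> \<alpha> n > 0"
    and P_prob: "\<And>n. n \<ge> 1 \<Longrightarrow> prob_space (P n)"
    and Y_gamma: "\<And>n i. n \<ge> 1 \<Longrightarrow> i \<in> {1..n} \<Longrightarrow>
          distributed (P n) lborel (Y n i) (\<lambda>u. ennreal (gamma_density (\<alpha> n) u))"
    and Y_indep: "\<And>n. n \<ge> 1 \<Longrightarrow> prob_space.indep_vars (P n) (\<lambda>_. borel) (Y n) {1..n}"
    and M_def: "\<And>n \<omega>. n \<ge> 1 \<Longrightarrow> M n \<omega> = Max ((\<lambda>i. Y n i \<omega>) ` {1..n})"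
    and \<alpha>_bdd: "bdd_above (\<alpha> ` {1..})"
    and n\<alpha>_lim: "filterlim (\<lambda>n. real n * \<alpha> n) at_top sequentially"
    and away: "\<exists>c>0. eventually (\<lambda>n. \<bar>ln (\<alpha> n) / ln (real n)\<bar> \<ge> c) sequentially"
  shows "weak_conv_m
    (\<lambda>n. distr (P n) borel
      (\<lambda>\<omega>. M n \<omega> - ln (real n * \<alpha> n) - (\<alpha> n - 1) * ln (ln (real n * \<alpha> n))))
    gumbel"
  unfolding weak_conv_m_def weak_conv_def
proof (intro allI impI)
  fix t :: real
  \<comment> \<open>Solving the normalised event for the maximum: it is at most \<open>t\<close>
    exactly when \<open>M n \<omega> \<le> x n\<close>.\<close>
  define x where "x n = ln (real n * \<alpha> n) + (\<alpha> n - 1) * ln (ln (real n * \<alpha> n)) + t" for n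
  define C where "C n = x n powr (\<alpha> n - 1) * exp (- x n) / Gamma (\<alpha> n)" for n
  \<comment> \<open>Index 1 represents all indices, since the variables of a row share one
    density.\<close>
  define p where "p n = measure (P n) (Y n 1 -` {x n<..} \<inter> space (P n))" for n
  let ?Q = "\<lambda>n. distr (P n) borel
      (\<lambda>\<omega>. M n \<omega> - ln (real n * \<alpha> n) - (\<alpha> n - 1) * ln (ln (real n * \<alpha> n)))"
  from away obtain c where "c > 0" "\<forall>\<^sub>F n in sequentially. \<bar>ln (\<alpha> n) / ln (real n)\<bar> \<ge> c"
    by blast
  then have \<alpha>0: "\<alpha> \<longlonglongrightarrow> 0"
    using \<alpha>_pos \<alpha>_bdd by (intro tendsto_zero_of_ln_ratio)
  have X: "filterlim x at_top sequentially" and nC: "(\<lambda>n. real n * C n) \<longlonglongrightarrow> exp (- t)"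
    unfolding C_def x_def using tendsto_gumbel_tail[OF \<alpha>_pos \<alpha>0 n\<alpha>_lim, of t] by auto
  \<comment> \<open>This is \<open>y / (y + 1)\<close>, the ratio of the lower to the upper tail
    bound, in a form whose limit 1 is immediate.\<close>
  have "((\<lambda>y::real. 1 - 1 / (y + 1)) \<longlongrightarrow> 1 - 0) at_top"
    by (intro tendsto_intros real_tendsto_divide_at_top[OF tendsto_const]
        filterlim_at_top_mono[OF filterlim_ident]) auto
  note factor = filterlim_compose[OF this X]
  \<comment> \<open>The tail bounds require shape at most 1 and a positive threshold;
    \<open>\<alpha>\<close> tending to 0 and \<open>x\<close> tending to infinity provide both
    eventually.\<close>
  have bounds: "\<forall>\<^sub>F n in sequentially. C n * (1 - 1 / (x n + 1)) \<le> p n \<and> p n \<le> C n"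
    using filterlim_at_top_dense[THEN iffD1, OF X, rule_format, of 0]
      order_tendstoD(2)[OF \<alpha>0, of 1, simplified] eventually_ge_at_top[of 1]
  proof eventually_elim
    case (elim n)
    have "distributed (P n) lborel (Y n 1) (\<lambda>u. ennreal (gamma_density (\<alpha> n) u))"
      using elim by (intro Y_gamma) auto
    from prob_space.gamma_tail_bounds[OF P_prob this \<alpha>_pos, of "x n"] elim
    have "C n * (x n / (x n + 1)) \<le> p n" "p n \<le> C n"
      by (auto simp: p_def C_def)
    moreover have "x n / (x n + 1) = 1 - 1 / (x n + 1)" using elim by (simp add: field_simps)
    ultimately show ?case by simp
  qed
  have "(\<lambda>n. real n * p n) \<longlonglongrightarrow> exp (- t)"
  proof (rule tendsto_sandwich)
    show "(\<lambda>n. real n * C n * (1 - 1 / (x n + 1))) \<longlonglongrightarrow> exp (- t)"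
      using tendsto_mult[OF nC factor] by simp
    show "\<forall>\<^sub>F n in sequentially. real n * C n * (1 - 1 / (x n + 1)) \<le> real n * p n"
      using bounds by eventually_elim (simp add: mult.assoc mult_left_mono)
    show "\<forall>\<^sub>F n in sequentially. real n * p n \<le> real n * C n"
      using bounds by eventually_elim (simp add: mult_left_mono)
  qed (rule nC)
  then have "(\<lambda>n. (1 - p n) ^ n) \<longlonglongrightarrow> exp (- exp (- t))"
    by (intro tendsto_one_minus_power) (auto simp: p_def)
  \<comment> \<open>The assumptions on the rows start at \<open>n = 1\<close>, so the identification
    with the distribution function is an eventual one.\<close>
  moreover have "\<forall>\<^sub>F n in sequentially. (1 - p n) ^ n = cdf (?Q n) t"
    using eventually_ge_at_top[of 1]
  proof eventually_elim
    case (elim n)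
    interpret prob_space "P n" by (rule P_prob[OF elim])
    have Ym [measurable]: "Y n i \<in> borel_measurable (P n)" if "i \<in> {1..n}" for i
      using Y_indep[OF elim] that by (auto simp: indep_vars_def)
    have tail: "prob (Y n i -` {x n<..} \<inter> space (P n)) = p n" if "i \<in> {1..n}" for i
      unfolding p_def using elim that
      by (simp add: measure_def distributed_emeasure[OF Y_gamma])
    have [measurable]: "M n \<in> borel_measurable (P n)"
      unfolding M_def[OF elim, abs_def] by (rule borel_measurable_Max) (auto intro: Ym)
    have "cdf (?Q n) t = prob ((\<lambda>\<omega>. M n \<omega> - ln (real n * \<alpha> n) - (\<alpha> n - 1) * ln (ln (real n * \<alpha> n)))
        -` {..t} \<inter> space (P n))"
      unfolding cdf_def by (rule measure_distr) auto
    also have "\<dots> = prob {\<omega> \<in> space (P n). Max ((\<lambda>i. Y n i \<omega>) ` {1..n}) \<le> x n}"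
      by (rule arg_cong[where f = prob]) (auto simp: x_def M_def[OF elim])
    also have "\<dots> = (1 - p n) ^ n"
      by (rule prob_Max_iid_le[OF Y_indep[OF elim] elim tail])
    finally show ?case by simp
  qed
  ultimately have "(\<lambda>n. cdf (?Q n) t) \<longlonglongrightarrow> exp (- exp (- t))"
    using Lim_transform_eventually by fastforce
  then show "(\<lambda>n. cdf (?Q n) t) \<longlonglongrightarrow> cdf gumbel t"
    by (simp add: cdf_gumbel gumbel_cdf_def)
qed

end
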